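(* Let $\boldsymbol X\in\mathbb R^{n_1\times n_2}$ have rank $r$ and SVD $\boldsymbol X=\boldsymbol U_{\boldsymbol X}\boldsymbol\Sigma_{\boldsymbol X}\boldsymbol V_{\boldsymbol X}^\top$. Assume that the perturbation matrix $\boldsymbol N\in\mathbb R^{n_1\times n_2}$ satisfies $\|\boldsymbol N\|_F<\sigma_r(\boldsymbol X)/2$. Then the projective retraction $\mathcal R^{\mathsf{proj}}_{\boldsymbol X}$ and the orthographic retraction $\mathcal R^{\mathsf{orth}}_{\boldsymbol X}$ have the first-order perturbation expansions $$\mathcal R^{\mathsf{proj}}_{\boldsymbol X}(\boldsymbol N)=\mathcal P_{\mathbb T_{\boldsymbol X}}(\boldsymbol X+\boldsymbol N)+\mathcal O(\|\boldsymbol N\|_F^2),$$ $$\mathcal R^{\mathsf{orth}}_{\boldsymbol X}(\boldsymbol N)=\mathcal P_{\mathbb T_{\boldsymbol X}}(\boldsymbol X+\boldsymbol N)+\mathcal O(\|\boldsymbol N\|_F^2).$$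
   Context: In the SVD, $\boldsymbol U_{\boldsymbol X}\in\mathbb R^{n_1\times r}$ and $\boldsymbol V_{\boldsymbol X}\in\mathbb R^{n_2\times r}$ have orthonormal columns and $\boldsymbol\Sigma_{\boldsymbol X}$ is the $r\times r$ diagonal matrix of the singular values; $\sigma_r(\boldsymbol X)$ is the $r$-th (smallest non-zero) singular value. $P_{\boldsymbol U}=\boldsymbol U\boldsymbol U^\top$. The orthogonal projection onto the tangent space $\mathbb T_{\boldsymbol X}$ at $\boldsymbol X$ of the manifold of rank-$r$ matrices is $$\mathcal P_{\mathbb T_{\boldsymbol X}}(\boldsymbol Z)=P_{\boldsymbol U_{\boldsymbol X}}\boldsymbol Z+\boldsymbol ZP_{\boldsymbol V_{\boldsymbol X}}-P_{\boldsymbol U_{\boldsymbol X}}\boldsymbol ZP_{\boldsymbol V_{\boldsymbol X}}.$$ The retractions are given by $$\mathcal R^{\mathsf{proj}}_{\boldsymbol X}(\boldsymbol\delta)=\mathcal P_r(\boldsymbol X+\boldsymbol\delta),\qquad \mathcal R^{\mathsf{orth}}_{\boldsymbol X}(\boldsymbol\delta)=(\boldsymbol X+\boldsymbol\delta)\boldsymbol V_{\boldsymbol X}\left[\boldsymbol U_{\boldsymbol X}^\top(\boldsymbol X+\boldsymbol\delta)\boldsymbol V_{\boldsymbol X}\right]^{-1}\boldsymbol U_{\boldsymbol X}^\top(\boldsymbol X+\boldsymbol\delta),$$ where $\mathcal P_r$ is the rank-$r$ truncated SVD (keep the $r$ largest singular values and their singular vectors). These formulas are applied to the perturbation matrix $\boldsymbol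 N$. The term $\mathcal O(\|\boldsymbol N\|_F^2)$ denotes a matrix whose Frobenius norm is at most a constant (which may depend on $\boldsymbol X$ but not on $\boldsymbol N$) times $\|\boldsymbol N\|_F^2$. *)

theory Defs
  imports "HOL-Analysis.Analysis"
begin

text \<open>
  An \<open>m \<times> n\<close> real matrix has type \<open>real ^ 'n ^ 'm\<close>, and \<open>norm\<close> on that type is the
  Frobenius norm.
\<close>

definition outer :: "real ^ 'm \<Rightarrow> real ^ 'n \<Rightarrow> real ^ 'n ^ 'm" where
  "outer u v = (\<chi> i j. u $ i * v $ j)"

definition min_dim :: "real ^ 'n ^ 'm \<Rightarrow> nat" where
  "min_dim A = min CARD('m) CARD('n)"

text \<open>
  Singular value decomposition with zero singular values included. Indices run from
  \<open>1\<close> to \<open>min_dim A\<close>; values of the sequences elsewhere are irrelevant.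
\<close>

definition is_svd ::
  "real ^ 'n ^ 'm \<Rightarrow> (nat \<Rightarrow> real) \<Rightarrow> (nat \<Rightarrow> real ^ 'm) \<Rightarrow> (nat \<Rightarrow> real ^ 'n) \<Rightarrow> bool" where
  "is_svd A \<sigma> u v \<longleftrightarrow>
     (\<forall>i\<in>{1..min_dim A}. 0 \<le> \<sigma> i) \<and>
     (\<forall>i\<in>{1..min_dim A}. \<forall>j\<in>{1..min_dim A}. i \<le> j \<longrightarrow> \<sigma> j \<le> \<sigma> i) \<and>
     (\<forall>i\<in>{1..min_dim A}. \<forall>j\<in>{1..min_dim A}. u i \<bullet> u j = (if i = j then 1 else 0)) \<and>
     (\<forall>i\<in>{1..min_dim A}. \<forall>j\<in>{1..min_dim A}. v i \<bullet> v j = (if i = j then 1 else 0)) \<and>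
     A = (\<Sum>i=1..min_dim A. \<sigma> i *\<^sub>R outer (u i) (v i))"

text \<open>The \<open>k\<close>-th largest singular value, counted with multiplicity, for \<open>1 \<le> k \<le> min_dim A\<close>.\<close>

definition singular_value :: "real ^ 'n ^ 'm \<Rightarrow> nat \<Rightarrow> real" where
  "singular_value A k = (THE s. \<exists>\<sigma> u v. is_svd A \<sigma> u v \<and> s = \<sigma> k)"

text \<open>
  The truncation is unique only if the \<open>r\<close>-th and \<open>(r + 1)\<close>-st singular values differ (or one
  of them is \<open>0\<close>, or \<open>r \<ge> min_dim A\<close>); ties are broken by an arbitrary choice of SVD.
\<close>

definition truncated_svd :: "nat \<Rightarrow> real ^ 'n ^ 'm \<Rightarrow> real ^ 'n ^ 'm" where
  "truncated_svd r A =
     (SOME Z. \<exists>\<sigma> u v. is_svd A \<sigma> u v \<and>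
        Z = (\<Sum>i=1..min r (min_dim A). \<sigma> i *\<^sub>R outer (u i) (v i)))"

text \<open>
  The compact decomposition \<open>X = U \<Sigma> V\<^sup>T\<close>, in which \<open>r\<close> is the cardinality of the index type
  \<open>'r\<close>. That type carries no order, so the order of the singular values on the diagonal is
  left open; no notion below depends on it.
\<close>

definition is_compact_svd ::
  "real ^ 'n ^ 'm \<Rightarrow> real ^ 'r ^ 'm \<Rightarrow> real ^ 'r ^ 'r \<Rightarrow> real ^ 'r ^ 'n \<Rightarrow> bool" where
  "is_compact_svd X U S V \<longleftrightarrow>
     transpose U ** U = mat 1 \<and>
     transpose V ** V = mat 1 \<and>
     (\<forall>i j. i \<noteq> j \<longrightarrow> S $ i $ j = 0) \<and>
     (\<forall>i. 0 < S $ i $ i) \<and>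
     X = U ** S ** transpose V"

definition col_proj :: "real ^ 'r ^ 'm \<Rightarrow> real ^ 'm ^ 'm" where
  "col_proj U = U ** transpose U"

definition tangent_proj ::
  "real ^ 'r ^ 'm \<Rightarrow> real ^ 'r ^ 'n \<Rightarrow> real ^ 'n ^ 'm \<Rightarrow> real ^ 'n ^ 'm" where
  "tangent_proj U V Z =
     col_proj U ** Z + Z ** col_proj V - col_proj U ** Z ** col_proj V"

definition retr_proj :: "nat \<Rightarrow> real ^ 'n ^ 'm \<Rightarrow> real ^ 'n ^ 'm \<Rightarrow> real ^ 'n ^ 'm" where
  "retr_proj r X D = truncated_svd r (X + D)"

definition retr_orth ::
  "real ^ 'r ^ 'm \<Rightarrow> real ^ 'r ^ 'n \<Rightarrow> real ^ 'n ^ 'm \<Rightarrow> real ^ 'n ^ 'm \<Rightarrow> real ^ 'n ^ 'm" where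
  "retr_orth U V X D =
     (X + D) ** V ** matrix_inv (transpose U ** (X + D) ** V) ** transpose U ** (X + D)"

end

theory Submission
  imports Defs
begin

text \<open>
  Write \<open>P = col_proj U\<close>, \<open>Q = col_proj V\<close>, \<open>Y = X + N\<close> and \<open>s\<close> for the \<open>r\<close>-th singular value
  of \<open>X\<close>. The projection onto the normal space at \<open>X\<close> maps \<open>Z\<close> to \<open>(1 - P) Z (1 - Q)\<close>.

  Projective retraction: split the SVD of \<open>Y\<close> into rank-one terms \<open>\<sigma>\<^sub>i u\<^sub>i v\<^sub>i\<^sup>T\<close>. By Weyl's inequality
  \<open>\<sigma>\<^sub>i \<ge> s / 2\<close> for \<open>i \<le> r\<close> and \<open>\<sigma>\<^sub>i \<le> norm N\<close> for \<open>i > r\<close>. Since \<open>(1 - P) X = 0 = X (1 - Q)\<close>,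
  \<open>\<sigma>\<^sub>i (1 - P) u\<^sub>i = (1 - P) N v\<^sub>i\<close> and likewise for \<open>v\<^sub>i\<close>, so the normal part of a kept term has norm
  at most \<open>(norm N)\<^sup>2 / \<sigma>\<^sub>i\<close>. For a discarded term \<open>X\<^sup>T u\<^sub>i = \<sigma>\<^sub>i v\<^sub>i - N\<^sup>T u\<^sub>i\<close> has norm at most
  \<open>2 norm N\<close>, whence \<open>P u\<^sub>i\<close> and \<open>Q v\<^sub>i\<close> have norm at most \<open>2 norm N / s\<close>, and the tangent part of that
  term is of second order.

  Orthographic retraction: with \<open>M = U\<^sup>T Y V\<close>, the difference to the tangent projection is exactly
  \<open>(1 - P) N V M\<^sup>-\<^sup>1 U\<^sup>T N (1 - Q)\<close>, and \<open>M\<^sup>-\<^sup>1\<close> has operator norm at most \<open>2 / s\<close>.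
\<close>

subsection \<open>Orthonormal families\<close>

text \<open>Indexed by naturals, as in \<open>is_svd\<close>, so that initial segments
  \<open>{1..k}\<close> give the leading singular vectors.\<close>

definition orthonormal_family :: "nat set \<Rightarrow> (nat \<Rightarrow> 'a::real_inner) \<Rightarrow> bool" where
  "orthonormal_family K e \<longleftrightarrow> (\<forall>i\<in>K. \<forall>j\<in>K. e i \<bullet> e j = (if i = j then 1 else 0))"

lemma orthonormal_familyD:
  assumes "orthonormal_family K e" "i \<in> K" "j \<in> K"
  shows "e i \<bullet> e j = (if i = j then 1 else 0)"
  using assms by (simp add: orthonormal_family_def)

lemma orthonormal_family_norm:
  assumes "orthonormal_family K e" "i \<in> K"
  shows "norm (e i) = 1"
  using orthonormal_familyD[OF assms(1,2,2)] by (simp add: norm_eq_sqrt_inner)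

lemma orthonormal_family_subset:
  "orthonormal_family K e \<Longrightarrow> L \<subseteq> K \<Longrightarrow> orthonormal_family L e"
  unfolding orthonormal_family_def by blast

lemma orthonormal_family_inner_sum:
  assumes "orthonormal_family K e" "finite K" "i \<in> K"
  shows "e i \<bullet> (\<Sum>j\<in>K. c j *\<^sub>R e j) = c i"
proof -
  have "e i \<bullet> (\<Sum>j\<in>K. c j *\<^sub>R e j) = (\<Sum>j\<in>K. if i = j then c j else 0)"
    unfolding inner_sum_right inner_scaleR_right
    using assms by (intro sum.cong) (auto simp: orthonormal_familyD)
  then show ?thesis using assms by simp
qed

lemma orthonormal_family_norm_sum:
  assumes "orthonormal_family K e" "finite K"
  shows "(norm (\<Sum>j\<in>K. c j *\<^sub>R e j))\<^sup>2 = (\<Sum>j\<in>K. (c j)\<^sup>2)"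
proof -
  have "(norm (\<Sum>j\<in>K. c j *\<^sub>R e j))\<^sup>2 = (\<Sum>i\<in>K. c i * (e i \<bullet> (\<Sum>j\<in>K. c j *\<^sub>R e j)))"
    by (simp add: power2_norm_eq_inner inner_sum_left)
  also have "\<dots> = (\<Sum>j\<in>K. (c j)\<^sup>2)"
    using assms by (intro sum.cong) (auto simp: orthonormal_family_inner_sum power2_eq_square)
  finally show ?thesis .
qed

lemma orthonormal_family_span:
  assumes "orthonormal_family K e" "finite K" "w \<in> span (e ` K)"
  shows "w = (\<Sum>j\<in>K. (e j \<bullet> w) *\<^sub>R e j)"
  using assms(3)
proof (induction rule: span_induct_alt)
  case base
  then show ?case by simp
next
  case (step c x y)
  then obtain i where i: "i \<in> K" "x = e i" by blast
  have "(\<Sum>j\<in>K. (e j \<bullet> x) *\<^sub>R e j) = (\<Sum>j\<in>K. if i = j then e j else 0)"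
    using assms i by (intro sum.cong) (auto simp: orthonormal_familyD)
  also have "\<dots> = x" using assms i by simp
  finally have "x = (\<Sum>j\<in>K. (e j \<bullet> x) *\<^sub>R e j)" ..
  then show ?case
    using step.IH
    by (simp add: inner_add_right scaleR_add_left sum.distrib flip: scaleR_scaleR scaleR_sum_right)
qed

lemma orthonormal_family_bessel:
  assumes "orthonormal_family K e" "finite K"
  shows "(\<Sum>j\<in>K. (e j \<bullet> w)\<^sup>2) \<le> (norm w)\<^sup>2"
proof -
  let ?p = "\<Sum>j\<in>K. (e j \<bullet> w) *\<^sub>R e j"
  have "?p \<bullet> w = (\<Sum>j\<in>K. (e j \<bullet> w)\<^sup>2)"
    by (simp add: inner_sum_left power2_eq_square)
  moreover have "0 \<le> (norm (w - ?p))\<^sup>2" by simp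
  ultimately show ?thesis
    using orthonormal_family_norm_sum[OF assms, of "\<lambda>j. e j \<bullet> w"]
    by (simp add: power2_norm_eq_inner inner_diff_left inner_diff_right inner_commute)
qed

lemma orthonormal_family_inj_on:
  assumes "orthonormal_family K e"
  shows "inj_on e K"
proof (rule inj_onI)
  fix i j assume ij: "i \<in> K" "j \<in> K" "e i = e j"
  then show "i = j"
    using orthonormal_familyD[OF assms, of i j] orthonormal_familyD[OF assms, of j j]
    by (auto split: if_splits)
qed

lemma orthonormal_family_dim:
  fixes e :: "nat \<Rightarrow> 'a::euclidean_space"
  assumes "orthonormal_family K e"
  shows "dim (e ` K) = card K"
proof -
  have "pairwise orthogonal (e ` K)"
    unfolding pairwise_def orthogonal_def using orthonormal_familyD[OF assms] by auto
  moreover have "0 \<notin> e ` K"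
    using orthonormal_family_norm[OF assms] by force
  ultimately have "independent (e ` K)"
    by (rule pairwise_orthogonal_independent)
  then show ?thesis
    by (simp add: dim_eq_card_independent card_image orthonormal_family_inj_on[OF assms])
qed

lemma orthonormal_family_complete:
  fixes e :: "nat \<Rightarrow> 'a::euclidean_space"
  assumes "orthonormal_family K e" "finite K" "card K = DIM('a)"
  shows "w = (\<Sum>j\<in>K. (e j \<bullet> w) *\<^sub>R e j)"
proof -
  have "span (e ` K) = UNIV"
    using orthonormal_family_dim[OF assms(1)] assms(3) by (simp add: dim_eq_full)
  then show ?thesis using orthonormal_family_span[OF assms(1,2)] by simp
qed

text \<open>Fewer than \<open>dim S\<close> linear conditions leave a nonzero solution in
  \<open>span S\<close>. The map \<open>g\<close> satisfies
  \<open>w \<bullet> g w = (\<Sum>j\<in>L. (f j \<bullet> w)\<^sup>2)\<close>, so its kernel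
  consists of the common solutions. Were that kernel trivial on \<open>span S\<close>,
  \<open>g\<close> would embed this space into the span of at most \<open>card L\<close>
  vectors.\<close>

lemma span_orthogonal_exists:
  fixes S :: "'a::euclidean_space set"
  assumes "finite L" "card L < dim S"
  obtains w where "w \<in> span S" "w \<noteq> 0" "\<And>j. j \<in> L \<Longrightarrow> f j \<bullet> w = 0"
proof (rule ccontr)
  note found = that
  assume neg: "\<not> thesis"
  define g where "g w = (\<Sum>j\<in>L. (f j \<bullet> w) *\<^sub>R f j)" for w
  have lin: "linear g"
    by (rule linearI)
      (simp_all add: g_def inner_add_right scaleR_add_left sum.distrib scaleR_sum_right)
  have zero: "w = 0" if "w \<in> span S" "g w = 0" for w
  proof (rule ccontr)
    assume "w \<noteq> 0"
    have "w \<bullet> g w = (\<Sum>j\<in>L. (f j \<bullet> w)\<^sup>2)"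
      by (simp add: g_def inner_sum_right power2_eq_square inner_commute)
    then have "(\<Sum>j\<in>L. (f j \<bullet> w)\<^sup>2) = 0" using \<open>g w = 0\<close> by simp
    then have "\<forall>j\<in>L. f j \<bullet> w = 0"
      using assms(1) by (simp add: sum_nonneg_eq_0_iff)
    then show False using neg found[of w] that(1) \<open>w \<noteq> 0\<close> by blast
  qed
  have "inj_on g (span S)"
    using zero by (simp add: linear_injective_on_subspace_0[OF lin])
  then have "dim (g ` S) = dim S" by (rule dim_image_eq[OF lin])
  moreover have "g ` S \<subseteq> span (f ` L)"
    unfolding image_subset_iff g_def by (intro ballI span_sum span_scale span_base imageI)
  then have "dim (g ` S) \<le> card (f ` L)"
    using assms(1) by (simp add: dim_le_card)
  moreover have "card (f ` L) \<le> card L"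
    using assms(1) by (rule card_image_le)
  ultimately show False using assms(2) by linarith
qed

lemma unit_orthogonal_exists:
  fixes f :: "nat \<Rightarrow> 'a::euclidean_space"
  assumes "finite L" "card L < DIM('a)"
  obtains w where "norm w = 1" "\<And>j. j \<in> L \<Longrightarrow> f j \<bullet> w = 0"
proof -
  have "card L < dim (UNIV :: 'a set)" using assms by simp
  then obtain w where w: "w \<noteq> 0" "\<And>j. j \<in> L \<Longrightarrow> f j \<bullet> w = 0"
    using span_orthogonal_exists[OF assms(1), of UNIV f] by blast
  show thesis
    by (rule that[of "w /\<^sub>R norm w"]) (simp_all add: w)
qed

subsection \<open>Singular value decomposition\<close>

text \<open>Since \<open>a\<close> obeys the constraints itself, \<open>a /\<^sub>R norm a\<close>
  competes in the maximization, so \<open>norm a \<le> x \<bullet> a\<close>. This is equality in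
  Cauchy-Schwarz and makes \<open>a\<close> parallel to \<open>x\<close>. It turns maximality into
  the singular vector equations.\<close>

lemma unit_maximizer:
  fixes a x :: "'a::real_inner"
  assumes x: "norm x = 1"
    and le: "\<And>y. norm y = 1 \<Longrightarrow> (\<And>j. j \<in> L \<Longrightarrow> f j \<bullet> y = 0) \<Longrightarrow> y \<bullet> a \<le> x \<bullet> a"
    and a: "\<And>j. j \<in> L \<Longrightarrow> f j \<bullet> a = 0"
    and nonneg: "0 \<le> x \<bullet> a"
  shows "a = (x \<bullet> a) *\<^sub>R x"
proof -
  have "norm a \<le> x \<bullet> a"
  proof (cases "a = 0")
    case False
    have "(a /\<^sub>R norm a) \<bullet> a \<le> x \<bullet> a"
      by (rule le) (use a False in auto)
    then show ?thesis using False by (simp add: dot_square_norm power2_eq_square field_simps)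
  qed (use nonneg in simp)
  moreover have "x \<bullet> a \<le> norm a" using norm_cauchy_schwarz[of x a] x by simp
  ultimately have "norm x * norm a = x \<bullet> a" using x by simp
  then show ?thesis using norm_cauchy_schwarz_eq[of x a] x by simp
qed

text \<open>
  The triples are chosen greedily, maximizing \<open>x \<bullet> (A *v y)\<close> over the unit vectors orthogonal to
  those already found. The last conjunct makes the next maximum no larger than the previous ones.
\<close>

lemma singular_vectors_exist:
  fixes A :: "real ^ 'n ^ 'm"
  assumes "k \<le> min_dim A"
  shows "\<exists>\<sigma> u v. orthonormal_family {1..k} u \<and> orthonormal_family {1..k} v \<and>
    (\<forall>i\<in>{1..k}. 0 \<le> \<sigma> i \<and> A *v v i = \<sigma> i *\<^sub>R u i \<and> u i v* A = \<sigma> i *\<^sub>R v i) \<and>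
    (\<forall>i\<in>{1..k}. \<forall>j\<in>{1..k}. i \<le> j \<longrightarrow> \<sigma> j \<le> \<sigma> i) \<and>
    (\<forall>x y. norm x = 1 \<and> norm y = 1 \<and> (\<forall>j\<in>{1..k}. u j \<bullet> x = 0 \<and> v j \<bullet> y = 0) \<longrightarrow>
      (\<forall>i\<in>{1..k}. x \<bullet> (A *v y) \<le> \<sigma> i))"
  using assms
proof (induction k)
  case 0
  show ?case by (simp add: orthonormal_family_def)
next
  case (Suc k)
  obtain \<sigma> u v where IH:
    "orthonormal_family {1..k} u \<and> orthonormal_family {1..k} v \<and>
    (\<forall>i\<in>{1..k}. 0 \<le> \<sigma> i \<and> A *v v i = \<sigma> i *\<^sub>R u i \<and> u i v* A = \<sigma> i *\<^sub>R v i) \<and>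
    (\<forall>i\<in>{1..k}. \<forall>j\<in>{1..k}. i \<le> j \<longrightarrow> \<sigma> j \<le> \<sigma> i) \<and>
    (\<forall>x y. norm x = 1 \<and> norm y = 1 \<and> (\<forall>j\<in>{1..k}. u j \<bullet> x = 0 \<and> v j \<bullet> y = 0) \<longrightarrow>
      (\<forall>i\<in>{1..k}. x \<bullet> (A *v y) \<le> \<sigma> i))"
    using Suc.IH[OF Suc_leD[OF Suc.prems]] by (elim exE)
  then have u: "orthonormal_family {1..k} u" and v: "orthonormal_family {1..k} v" by simp_all
  have sv: "0 \<le> \<sigma> i \<and> A *v v i = \<sigma> i *\<^sub>R u i \<and> u i v* A = \<sigma> i *\<^sub>R v i"
    if "i \<in> {1..k}" for i using IH that by simp
  have dec: "\<sigma> j \<le> \<sigma> i" if "i \<in> {1..k}" "j \<in> {1..k}" "i \<le> j" for i j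
    using IH that by simp
  have mx: "x \<bullet> (A *v y) \<le> \<sigma> i"
    if "norm x = 1" "norm y = 1" "\<forall>j\<in>{1..k}. u j \<bullet> x = 0 \<and> v j \<bullet> y = 0" "i \<in> {1..k}"
    for x y i
    using IH that by blast
  have k: "k < CARD('m)" "k < CARD('n)" using Suc.prems by (auto simp: min_dim_def)
  \<comment> \<open>The admissible unit vectors on either side. Both sets are compact, and nonempty
    because \<open>k\<close> is below both dimensions.\<close>
  define DU where "DU = sphere 0 1 \<inter> (\<Inter>j\<in>{1..k}. {x. u j \<bullet> x = 0})"
  define DV where "DV = sphere 0 1 \<inter> (\<Inter>j\<in>{1..k}. {x. v j \<bullet> x = 0})"
  have comp: "compact (DU \<times> DV)"
    unfolding DU_def DV_def
    by (intro compact_Times compact_Int_closed compact_sphere closed_INT ballI closed_hyperplane)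
  obtain x0 where "norm x0 = 1" "\<And>j. j \<in> {1..k} \<Longrightarrow> u j \<bullet> x0 = 0"
    using unit_orthogonal_exists[of "{1..k}" u] k by auto
  moreover obtain y0 where "norm y0 = 1" "\<And>j. j \<in> {1..k} \<Longrightarrow> v j \<bullet> y0 = 0"
    using unit_orthogonal_exists[of "{1..k}" v] k by auto
  ultimately have xy0: "x0 \<in> DU" "y0 \<in> DV" by (auto simp: DU_def DV_def)
  have "continuous_on (DU \<times> DV) (\<lambda>p. fst p \<bullet> (A *v snd p))"
    by (intro continuous_intros linear_continuous_on_compose[OF _ matrix_vector_mul_linear])
  then obtain p where p: "p \<in> DU \<times> DV"
      "\<And>q. q \<in> DU \<times> DV \<Longrightarrow> fst q \<bullet> (A *v snd q) \<le> fst p \<bullet> (A *v snd p)"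
    using continuous_attains_sup[OF comp] xy0 by blast
  obtain x y where pxy: "p = (x, y)" by (cases p)
  define s where "s = x \<bullet> (A *v y)"
  have le: "x' \<bullet> (A *v y') \<le> s" if "x' \<in> DU" "y' \<in> DV" for x' y'
    using p(2)[of "(x', y')"] that by (simp add: pxy s_def)
  have xy: "x \<in> DU" "y \<in> DV" using p(1) pxy by auto
  then have x: "norm x = 1" "\<And>j. j \<in> {1..k} \<Longrightarrow> u j \<bullet> x = 0"
    and y: "norm y = 1" "\<And>j. j \<in> {1..k} \<Longrightarrow> v j \<bullet> y = 0" by (auto simp: DU_def DV_def)
  \<comment> \<open>Flipping the sign of \<open>x\<close> stays admissible, so the maximum cannot be
    negative.\<close>
  have "- x \<in> DU" using xy by (auto simp: DU_def)
  then have s0: "0 \<le> s" using le[of "- x" y] xy by (simp add: s_def)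
  \<comment> \<open>With \<open>y\<close> fixed, \<open>x\<close> maximizes the inner product with
    \<open>A *v y\<close>. This vector is orthogonal to every earlier \<open>u j\<close>, because
    \<open>u j v* A\<close> is a multiple of \<open>v j\<close> and
    \<open>v j \<bullet> y = 0\<close>.\<close>
  have Ay: "A *v y = s *\<^sub>R x"
    unfolding s_def
  proof (rule unit_maximizer[where L = "{1..k}" and f = u])
    fix j assume j: "j \<in> {1..k}"
    show "u j \<bullet> (A *v y) = 0"
      using sv[OF j] y(2)[OF j] by (simp flip: dot_lmul_matrix)
  next
    fix z assume "norm z = 1" "\<And>j. j \<in> {1..k} \<Longrightarrow> u j \<bullet> z = 0"
    then show "z \<bullet> (A *v y) \<le> x \<bullet> (A *v y)"
      using le[of z y] xy by (auto simp: DU_def s_def)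
  qed (use x s0 s_def in auto)
  have s_eq: "s = y \<bullet> (x v* A)" by (metis s_def dot_lmul_matrix inner_commute)
  have xA: "x v* A = s *\<^sub>R y"
    unfolding s_eq
  proof (rule unit_maximizer[where L = "{1..k}" and f = v])
    fix j assume j: "j \<in> {1..k}"
    show "v j \<bullet> (x v* A) = 0"
      using sv[OF j] x(2)[OF j] by (simp add: inner_commute[of "v j"] dot_lmul_matrix)
        (simp add: inner_commute)
  next
    fix z assume "norm z = 1" "\<And>j. j \<in> {1..k} \<Longrightarrow> v j \<bullet> z = 0"
    then show "z \<bullet> (x v* A) \<le> y \<bullet> (x v* A)"
      using le[of x z] xy by (auto simp: DV_def s_eq inner_commute[of z] dot_lmul_matrix)
  qed (use y s0 s_eq in auto)
  have on: "orthonormal_family {1..Suc k} (e(Suc k := z))"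
    if "orthonormal_family {1..k} e" "norm z = 1" "\<And>j. j \<in> {1..k} \<Longrightarrow> e j \<bullet> z = 0"
    for e and z :: "'b::real_inner"
    unfolding orthonormal_family_def
  proof (intro ballI)
    fix i j assume "i \<in> {1..Suc k}" "j \<in> {1..Suc k}"
    then have "i \<in> {1..k} \<or> i = Suc k" "j \<in> {1..k} \<or> j = Suc k" by auto
    then show "(e(Suc k := z)) i \<bullet> (e(Suc k := z)) j = (if i = j then 1 else 0)"
      using orthonormal_familyD[OF that(1), of i j] that(2,3)
      by (elim disjE) (simp_all add: dot_square_norm inner_commute[of z])
  qed
  have new: "(\<sigma>(Suc k := s)) i = s \<and> (u(Suc k := x)) i = x \<and> (v(Suc k := y)) i = y"
    if "i = Suc k" for i using that by simp
  have old: "(\<sigma>(Suc k := s)) i = \<sigma> i \<and> (u(Suc k := x)) i = u i \<and> (v(Suc k := y)) i = v i"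
    if "i \<in> {1..k}" for i using that by auto
  have cases: "i \<in> {1..k} \<or> i = Suc k" if "i \<in> {1..Suc k}" for i using that by auto
  \<comment> \<open>The new pair was admissible at the earlier stages too, so the maximality
    invariant bounds its value.\<close>
  have s_le: "s \<le> \<sigma> i" if "i \<in> {1..k}" for i
    unfolding s_def using mx[of x y i] x y that by blast
  show ?case
  proof (intro exI conjI ballI allI impI)
    show "orthonormal_family {1..Suc k} (u(Suc k := x))" by (rule on[OF u x])
    show "orthonormal_family {1..Suc k} (v(Suc k := y))" by (rule on[OF v y])
    fix i assume i: "i \<in> {1..Suc k}"
    show "0 \<le> (\<sigma>(Suc k := s)) i"
      and "A *v (v(Suc k := y)) i = (\<sigma>(Suc k := s)) i *\<^sub>R (u(Suc k := x)) i"
      and "(u(Suc k := x)) i v* A = (\<sigma>(Suc k := s)) i *\<^sub>R (v(Suc k := y)) i"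
      using cases[OF i] sv[of i] old[of i] new[of i] s0 Ay xA by metis+
    show "(\<sigma>(Suc k := s)) j \<le> (\<sigma>(Suc k := s)) i" if j: "j \<in> {1..Suc k}" "i \<le> j" for j
      using cases[OF i] cases[OF j(1)] dec[of i j] s_le[of i] j(2) by auto
    fix z w
    assume zw: "norm z = 1 \<and> norm w = 1 \<and>
      (\<forall>j\<in>{1..Suc k}. (u(Suc k := x)) j \<bullet> z = 0 \<and> (v(Suc k := y)) j \<bullet> w = 0)"
    have "z \<in> DU" "w \<in> DV"
      using zw by (auto simp: DU_def DV_def dest!: bspec)
    then show "z \<bullet> (A *v w) \<le> (\<sigma>(Suc k := s)) i"
      using le[of z w] cases[OF i] s_le[of i] old[of i] new[of i] by auto
  qed
qed

section \<open>Rank-one matrices, the action of an SVD on vectors, existence of an SVD\<close>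

lemma outer_vector_mult: "outer a b *v w = (b \<bullet> w) *\<^sub>R a"
  by (simp add: vec_eq_iff outer_def matrix_vector_mult_def inner_vec_def sum_distrib_left
      sum_distrib_right mult_ac)

lemma vector_outer_mult: "w v* outer a b = (a \<bullet> w) *\<^sub>R b"
  by (simp add: vec_eq_iff outer_def vector_matrix_mult_def inner_vec_def sum_distrib_left
      sum_distrib_right mult_ac)

lemma norm_outer: "norm (outer a b) = norm a * norm b"
proof -
  have "outer a b \<bullet> outer a b = (a \<bullet> a) * (b \<bullet> b)"
    by (simp add: outer_def inner_vec_def sum_product sum_distrib_left sum_distrib_right mult_ac)
  then show ?thesis by (simp add: norm_eq_sqrt_inner real_sqrt_mult)
qed

lemma outer_scaleR_left: "outer (c *\<^sub>R a) b = c *\<^sub>R outer a b"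
  by (simp add: vec_eq_iff outer_def)

lemma sum_matrix_vector_mult: "(\<Sum>i\<in>K. M i) *v w = (\<Sum>i\<in>K. M i *v w)"
  by (induction K rule: infinite_finite_induct) (simp_all add: matrix_vector_mult_add_rdistrib)

lemma sum_vector_matrix_mult:
  fixes M :: "'i \<Rightarrow> real ^ 'n ^ 'm"
  shows "w v* (\<Sum>i\<in>K. M i) = (\<Sum>i\<in>K. w v* M i)"
  by (induction K rule: infinite_finite_induct) (simp_all add: vector_matrix_mult_add_rdistrib)

lemma matrix_eq_bilinear:
  fixes A B :: "real ^ 'n ^ 'm"
  assumes "\<And>x y. x \<bullet> (A *v y) = x \<bullet> (B *v y)"
  shows "A = B"
  unfolding matrix_eq using assms by (metis vector_eq_ldot)

lemma is_svd_families:
  assumes "is_svd A \<sigma> u v"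
  shows "orthonormal_family {1..min_dim A} u" and "orthonormal_family {1..min_dim A} v"
  using assms by (simp_all add: is_svd_def orthonormal_family_def)

lemma is_svd_nonneg: "is_svd A \<sigma> u v \<Longrightarrow> i \<in> {1..min_dim A} \<Longrightarrow> 0 \<le> \<sigma> i"
  by (simp add: is_svd_def)

lemma is_svd_decreasing:
  "is_svd A \<sigma> u v \<Longrightarrow> i \<in> {1..min_dim A} \<Longrightarrow> j \<in> {1..min_dim A} \<Longrightarrow> i \<le> j \<Longrightarrow> \<sigma> j \<le> \<sigma> i"
  by (simp add: is_svd_def)

lemma is_svd_sum:
  assumes "is_svd A \<sigma> u v"
  shows "A = (\<Sum>i=1..min_dim A. \<sigma> i *\<^sub>R outer (u i) (v i))"
  using assms unfolding is_svd_def by blast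

lemma is_svd_mult:
  assumes "is_svd A \<sigma> u v"
  shows "A *v w = (\<Sum>i=1..min_dim A. (\<sigma> i * (v i \<bullet> w)) *\<^sub>R u i)"
  by (subst is_svd_sum[OF assms])
    (simp add: sum_matrix_vector_mult outer_vector_mult flip: scaleR_matrix_vector_assoc)

lemma is_svd_mult_left:
  assumes "is_svd A \<sigma> u v"
  shows "w v* A = (\<Sum>i=1..min_dim A. (\<sigma> i * (u i \<bullet> w)) *\<^sub>R v i)"
  by (subst is_svd_sum[OF assms])
    (simp add: sum_vector_matrix_mult vector_outer_mult flip: outer_scaleR_left)

lemma is_svd_right_vector:
  assumes "is_svd A \<sigma> u v" "i \<in> {1..min_dim A}"
  shows "A *v v i = \<sigma> i *\<^sub>R u i"
proof -
  have "A *v v i = (\<Sum>j=1..min_dim A. if j = i then \<sigma> j *\<^sub>R u j else 0)"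
    unfolding is_svd_mult[OF assms(1)]
    using orthonormal_familyD[OF is_svd_families(2)[OF assms(1)] _ assms(2)]
    by (intro sum.cong) auto
  then show ?thesis using assms(2) by simp
qed

lemma is_svd_left_vector:
  assumes "is_svd A \<sigma> u v" "i \<in> {1..min_dim A}"
  shows "u i v* A = \<sigma> i *\<^sub>R v i"
proof -
  have "u i v* A = (\<Sum>j=1..min_dim A. if j = i then \<sigma> j *\<^sub>R v j else 0)"
    unfolding is_svd_mult_left[OF assms(1)]
    using orthonormal_familyD[OF is_svd_families(1)[OF assms(1)] _ assms(2)]
    by (intro sum.cong) auto
  then show ?thesis using assms(2) by simp
qed

text \<open>Take \<open>min_dim A\<close> greedy triples. On the side of smaller dimension their
  vectors form an orthonormal basis; expanding \<open>y\<close> or \<open>x\<close> in it shows that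
  the bilinear forms of \<open>A\<close> and of the sum agree.\<close>

lemma svd_exists:
  fixes A :: "real ^ 'n ^ 'm"
  shows "\<exists>\<sigma> u v. is_svd A \<sigma> u v"
proof -
  let ?K = "{1..min_dim A}"
  obtain \<sigma> u v where u: "orthonormal_family ?K u" and v: "orthonormal_family ?K v"
    and sv: "\<forall>i\<in>?K. 0 \<le> \<sigma> i \<and> A *v v i = \<sigma> i *\<^sub>R u i \<and> u i v* A = \<sigma> i *\<^sub>R v i"
    and dec: "\<forall>i\<in>?K. \<forall>j\<in>?K. i \<le> j \<longrightarrow> \<sigma> j \<le> \<sigma> i"
    using singular_vectors_exist[OF order_refl, of A] by blast
  have "A = (\<Sum>i=1..min_dim A. \<sigma> i *\<^sub>R outer (u i) (v i))" (is "_ = ?B")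
  proof (rule matrix_eq_bilinear)
    fix x y
    have B: "x \<bullet> (?B *v y) = (\<Sum>i\<in>?K. \<sigma> i * (v i \<bullet> y) * (u i \<bullet> x))"
      by (simp add: sum_matrix_vector_mult outer_vector_mult inner_sum_right inner_commute
          flip: scaleR_matrix_vector_assoc)
    show "x \<bullet> (A *v y) = x \<bullet> (?B *v y)"
    proof (cases "min_dim A = CARD('n)")
      case True
      then have "y = (\<Sum>i\<in>?K. (v i \<bullet> y) *\<^sub>R v i)"
        by (intro orthonormal_family_complete[OF v]) simp_all
      then have "A *v y = (\<Sum>i\<in>?K. (v i \<bullet> y) *\<^sub>R (A *v v i))"
        using linear_sum[OF matrix_vector_mul_linear[of A], of "\<lambda>i. (v i \<bullet> y) *\<^sub>R v i" ?K]
        by (simp add: matrix_vector_mult_scaleR)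
      then show ?thesis
        unfolding B using sv by (simp add: inner_sum_right inner_commute mult_ac)
    next
      case False
      then have "min_dim A = CARD('m)" by (simp add: min_dim_def min_def split: if_splits)
      then have "x = (\<Sum>i\<in>?K. (u i \<bullet> x) *\<^sub>R u i)"
        by (intro orthonormal_family_complete[OF u]) simp_all
      then have "x \<bullet> (A *v y) = (\<Sum>i\<in>?K. (u i \<bullet> x) *\<^sub>R u i) \<bullet> (A *v y)" by simp
      also have "\<dots> = (\<Sum>i\<in>?K. (u i \<bullet> x) * ((u i v* A) \<bullet> y))"
        by (simp add: inner_sum_left dot_lmul_matrix)
      finally show ?thesis
        unfolding B using sv by (simp add: mult_ac)
    qed
  qed
  then have "is_svd A \<sigma> u v"
    using u v sv dec unfolding is_svd_def orthonormal_family_def by blast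
  then show ?thesis by blast
qed

section \<open>Norm bounds, Courant-Fischer estimates and Weyl's inequality\<close>

lemma norm_matrix_vector_mult_le:
  fixes A :: "real ^ 'n ^ 'm"
  shows "norm (A *v x) \<le> norm A * norm x"
proof -
  have "(norm (A *v x))\<^sup>2 = (\<Sum>i\<in>UNIV. (A $ i \<bullet> x)\<^sup>2)"
    unfolding power2_norm_eq_inner inner_vec_def[of "A *v x"]
    by (simp add: matrix_vector_mult_def inner_vec_def power2_eq_square)
  also have "\<dots> \<le> (\<Sum>i\<in>UNIV. (norm (A $ i))\<^sup>2 * (norm x)\<^sup>2)"
    using Cauchy_Schwarz_ineq[of "A $ _" x] by (intro sum_mono) (simp add: power2_norm_eq_inner)
  also have "\<dots> = (norm A * norm x)\<^sup>2"
    by (simp add: norm_vec_def[of A] L2_set_def sum_nonneg power_mult_distrib sum_distrib_right)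
  finally show ?thesis by (rule power2_le_imp_le) simp
qed

lemma norm_transpose: "norm (transpose A) = norm (A :: real ^ 'n ^ 'm)"
proof -
  have "transpose A \<bullet> transpose A = A \<bullet> A"
    unfolding transpose_def inner_vec_def by simp (rule sum.swap)
  then show ?thesis by (simp add: norm_eq_sqrt_inner)
qed

lemma norm_vector_matrix_mult_le:
  fixes A :: "real ^ 'n ^ 'm"
  shows "norm (x v* A) \<le> norm A * norm x"
  using norm_matrix_vector_mult_le[of "transpose A" x] by (simp add: norm_transpose)

text \<open>Upper half of Courant-Fischer: only singular values from index \<open>k\<close> on act
  on \<open>w\<close>. Bessel's inequality suffices, as the \<open>v i\<close> need not span the
  space.\<close>

lemma is_svd_norm_le:
  assumes svd: "is_svd A \<sigma> u v" and k: "k \<in> {1..min_dim A}"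
    and w: "\<And>j. j \<in> {1..<k} \<Longrightarrow> v j \<bullet> w = 0"
  shows "norm (A *v w) \<le> \<sigma> k * norm w"
proof -
  have "(norm (A *v w))\<^sup>2 = (\<Sum>i=1..min_dim A. (\<sigma> i * (v i \<bullet> w))\<^sup>2)"
    unfolding is_svd_mult[OF svd]
    by (rule orthonormal_family_norm_sum[OF is_svd_families(1)[OF svd]]) simp
  also have "\<dots> \<le> (\<Sum>i=1..min_dim A. (\<sigma> k)\<^sup>2 * (v i \<bullet> w)\<^sup>2)"
  proof (rule sum_mono)
    fix i assume i: "i \<in> {1..min_dim A}"
    show "(\<sigma> i * (v i \<bullet> w))\<^sup>2 \<le> (\<sigma> k)\<^sup>2 * (v i \<bullet> w)\<^sup>2"
    proof (cases "i < k")
      case True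
      then show ?thesis using w[of i] i by simp
    next
      case False
      then have "\<sigma> i \<le> \<sigma> k" using is_svd_decreasing[OF svd k i] by simp
      then have "(\<sigma> i)\<^sup>2 \<le> (\<sigma> k)\<^sup>2" using is_svd_nonneg[OF svd i] by (rule power_mono)
      then show ?thesis by (simp add: power_mult_distrib mult_right_mono)
    qed
  qed
  also have "\<dots> \<le> (\<sigma> k)\<^sup>2 * (norm w)\<^sup>2"
    using orthonormal_family_bessel[OF is_svd_families(2)[OF svd], of w]
    by (simp add: mult_left_mono flip: sum_distrib_left)
  finally have "(norm (A *v w))\<^sup>2 \<le> (\<sigma> k * norm w)\<^sup>2" by (simp add: power_mult_distrib)
  then show ?thesis
    by (rule power2_le_imp_le) (use is_svd_nonneg[OF svd k] in simp)
qed

text \<open>Lower half of Courant-Fischer: \<open>w\<close> has components only along directions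
  that \<open>A\<close> stretches by at least \<open>\<sigma> k\<close>.\<close>

lemma is_svd_norm_ge:
  assumes svd: "is_svd A \<sigma> u v" and k: "k \<in> {1..min_dim A}"
    and w: "w \<in> span (v ` {1..k})"
  shows "\<sigma> k * norm w \<le> norm (A *v w)"
proof -
  have K: "{1..k} \<subseteq> {1..min_dim A}" using k by auto
  note v = orthonormal_family_subset[OF is_svd_families(2)[OF svd] K]
  have "w = (\<Sum>j=1..k. (v j \<bullet> w) *\<^sub>R v j)"
    by (rule orthonormal_family_span[OF v _ w]) simp
  then have "(norm w)\<^sup>2 = (\<Sum>j=1..k. (v j \<bullet> w)\<^sup>2)"
    using orthonormal_family_norm_sum[OF v, of "\<lambda>j. v j \<bullet> w"] by simp
  then have "(\<sigma> k * norm w)\<^sup>2 = (\<Sum>i=1..k. (\<sigma> k)\<^sup>2 * (v i \<bullet> w)\<^sup>2)"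
    by (simp add: power_mult_distrib sum_distrib_left)
  also have "\<dots> \<le> (\<Sum>i=1..k. (\<sigma> i * (v i \<bullet> w))\<^sup>2)"
  proof (rule sum_mono)
    fix i assume i: "i \<in> {1..k}"
    have "\<sigma> k \<le> \<sigma> i" using is_svd_decreasing[OF svd _ k, of i] i K by auto
    then have "(\<sigma> k)\<^sup>2 \<le> (\<sigma> i)\<^sup>2" using is_svd_nonneg[OF svd k] by (rule power_mono)
    then show "(\<sigma> k)\<^sup>2 * (v i \<bullet> w)\<^sup>2 \<le> (\<sigma> i * (v i \<bullet> w))\<^sup>2"
      by (simp add: power_mult_distrib mult_right_mono)
  qed
  also have "\<dots> \<le> (\<Sum>i=1..min_dim A. (\<sigma> i * (v i \<bullet> w))\<^sup>2)"
    by (rule sum_mono2[OF _ K]) simp_all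
  also have "\<dots> = (norm (A *v w))\<^sup>2"
    unfolding is_svd_mult[OF svd]
    by (rule orthonormal_family_norm_sum[OF is_svd_families(1)[OF svd], symmetric]) simp
  finally show ?thesis by (rule power2_le_imp_le) simp
qed

text \<open>The first \<open>k\<close> right singular vectors of \<open>B\<close> span a space of
  dimension \<open>k\<close>, while orthogonality to the first \<open>k - 1\<close> right singular
  vectors of \<open>A\<close> imposes one condition fewer. A nonzero vector meeting both
  requirements allows the two Courant-Fischer estimates to be compared.\<close>

lemma weyl_singular_values:
  fixes A B :: "real ^ 'n ^ 'm"
  assumes A: "is_svd A \<sigma> u v" and B: "is_svd B \<tau> x y" and k: "k \<in> {1..min_dim A}"
  shows "\<tau> k \<le> \<sigma> k + norm (A - B)"
proof -
  have kB: "k \<in> {1..min_dim B}" using k by (simp add: min_dim_def)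
  have "card {1..<k} < dim (y ` {1..k})"
    using orthonormal_family_dim[OF orthonormal_family_subset[OF is_svd_families(2)[OF B], of "{1..k}"]]
      kB by simp
  then obtain w where w: "w \<in> span (y ` {1..k})" "w \<noteq> 0" "\<And>j. j \<in> {1..<k} \<Longrightarrow> v j \<bullet> w = 0"
    using span_orthogonal_exists[of "{1..<k}" _ v] by blast
  have "\<tau> k * norm w \<le> norm (B *v w)" by (rule is_svd_norm_ge[OF B kB w(1)])
  also have "B *v w = A *v w - (A - B) *v w" by (simp add: matrix_vector_mult_diff_rdistrib)
  also have "norm \<dots> \<le> norm (A *v w) + norm ((A - B) *v w)" by (rule norm_triangle_ineq4)
  also have "\<dots> \<le> \<sigma> k * norm w + norm (A - B) * norm w"
    by (intro add_mono is_svd_norm_le[OF A k w(3)] norm_matrix_vector_mult_le)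
  finally show ?thesis using w(2) by (simp flip: distrib_right)
qed

text \<open>The description is unique: Weyl's inequality in both directions between two SVDs of the
  same matrix has error \<open>norm (A - A) = 0\<close>.\<close>

lemma singular_value_eq:
  assumes "is_svd A \<sigma> u v" "k \<in> {1..min_dim A}"
  shows "singular_value A k = \<sigma> k"
  unfolding singular_value_def
proof (rule the_equality)
  show "\<exists>\<sigma>' u v. is_svd A \<sigma>' u v \<and> \<sigma> k = \<sigma>' k" using assms by blast
next
  fix s assume "\<exists>\<sigma>' u v. is_svd A \<sigma>' u v \<and> s = \<sigma>' k"
  then obtain \<sigma>' u' v' where s: "is_svd A \<sigma>' u' v'" "s = \<sigma>' k" by blast
  show "s = \<sigma> k"
    using weyl_singular_values[OF assms(1) s(1) assms(2)]
      weyl_singular_values[OF s(1) assms(1,2)] s(2) by simp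
qed

text \<open>If \<open>\<sigma> k\<close> were positive, \<open>u 1\<close> to \<open>u k\<close>
  would all lie in the range of \<open>A\<close>, forcing \<open>k \<le> rank A\<close>.\<close>

lemma is_svd_beyond_rank:
  assumes svd: "is_svd A \<sigma> u v" and k: "k \<in> {1..min_dim A}" "rank A < k"
  shows "\<sigma> k = 0"
proof (rule ccontr)
  assume "\<sigma> k \<noteq> 0"
  then have pos: "0 < \<sigma> k" using is_svd_nonneg[OF svd k(1)] by simp
  have K: "{1..k} \<subseteq> {1..min_dim A}" using k by auto
  have "u i \<in> range ((*v) A)" if "i \<in> {1..k}" for i
  proof
    have "0 < \<sigma> i" using is_svd_decreasing[OF svd _ k(1), of i] that K pos by force
    then show "u i = A *v ((1 / \<sigma> i) *\<^sub>R v i)"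
      using is_svd_right_vector[OF svd, of i] that K by (auto simp: matrix_vector_mult_scaleR)
  qed simp
  then have "dim (u ` {1..k}) \<le> dim (range ((*v) A))" by (intro dim_subset) blast
  then show False
    using orthonormal_family_dim[OF orthonormal_family_subset[OF is_svd_families(1)[OF svd] K]] k(2)
    by (simp add: rank_dim_range)
qed

subsection \<open>Compact decompositions and the tangent projection\<close>

lemma norm_isometry_mult:
  fixes U :: "real ^ 'r ^ 'm"
  assumes "transpose U ** U = mat 1"
  shows "norm (U *v w) = norm w"
proof -
  have "(U *v w) \<bullet> (U *v w) = w \<bullet> ((transpose U ** U) *v w)"
    by (metis dot_lmul_matrix matrix_vector_mul_assoc transpose_matrix_vector inner_commute)
  then show ?thesis using assms by (simp add: norm_eq_sqrt_inner)
qed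

lemma isometry_transpose_mult:
  fixes U :: "real ^ 'r ^ 'm"
  assumes "transpose U ** U = mat 1"
  shows "(U *v w) v* U = w"
  using assms by (metis matrix_vector_mul_assoc matrix_vector_mul_lid transpose_matrix_vector)

lemma col_proj_mult: "col_proj U *v x = U *v (x v* U)"
  by (simp add: col_proj_def flip: matrix_vector_mul_assoc)

lemma mult_col_proj: "x v* col_proj U = col_proj U *v x"
  by (simp add: col_proj_def matrix_transpose_mul flip: transpose_matrix_vector)

lemma norm_col_proj_complement:
  assumes "transpose U ** U = mat 1"
  shows "(norm (col_proj U *v x))\<^sup>2 + (norm (x - col_proj U *v x))\<^sup>2 = (norm x)\<^sup>2"
proof -
  let ?p = "col_proj U *v x"
  have "?p \<bullet> x = ?p \<bullet> ?p"
    by (metis assms col_proj_mult dot_lmul_matrix inner_commute isometry_transpose_mult)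
  then show ?thesis
    by (simp add: power2_norm_eq_inner inner_diff_left inner_diff_right inner_commute)
qed

lemma norm_col_proj_le:
  fixes U :: "real ^ 'r ^ 'm"
  assumes "transpose U ** U = mat 1"
  shows "norm (col_proj U *v x) \<le> norm x" and "norm (x - col_proj U *v x) \<le> norm x"
proof -
  have p: "(norm (col_proj U *v x))\<^sup>2 \<le> (norm x)\<^sup>2"
    and q: "(norm (x - col_proj U *v x))\<^sup>2 \<le> (norm x)\<^sup>2"
    unfolding norm_col_proj_complement[OF assms, of x, symmetric] by simp_all
  show "norm (col_proj U *v x) \<le> norm x"
    by (rule power2_le_imp_le[OF p norm_ge_zero])
  show "norm (x - col_proj U *v x) \<le> norm x"
    by (rule power2_le_imp_le[OF q norm_ge_zero])
qed

lemma norm_isometry_transpose_le: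
  fixes U :: "real ^ 'r ^ 'm"
  assumes "transpose U ** U = mat 1"
  shows "norm (x v* U) \<le> norm x"
  using norm_col_proj_le(1)[OF assms, of x]
  by (simp add: col_proj_mult norm_isometry_mult[OF assms])

text \<open>A diagonal \<open>S\<close> is symmetric. This symmetry carries facts about
  \<open>U\<close> over to \<open>V\<close>.\<close>

lemma compact_svd_transpose:
  assumes "is_compact_svd X U S V"
  shows "is_compact_svd (transpose X) V S U"
proof -
  have "transpose S = S"
    using assms by (auto simp: is_compact_svd_def transpose_def vec_eq_iff) metis
  then show ?thesis
    using assms by (simp add: is_compact_svd_def matrix_transpose_mul matrix_mul_assoc)
qed

lemma compact_svd_mult:
  assumes "is_compact_svd X U S V"
  shows "X *v w = U *v (S *v (w v* V))"
  using assms by (simp add: is_compact_svd_def flip: matrix_vector_mul_assoc)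

lemma compact_svd_mult_left:
  assumes "is_compact_svd X U S V"
  shows "w v* X = V *v (S *v (w v* U))"
  using compact_svd_mult[OF compact_svd_transpose[OF assms], of w] by simp

lemma compact_svd_col_proj:
  assumes "is_compact_svd X U S V"
  shows "col_proj U *v (X *v w) = X *v w" and "X *v (col_proj V *v w) = X *v w"
proof -
  have "transpose U ** U = mat 1" "transpose V ** V = mat 1"
    using assms by (auto simp: is_compact_svd_def)
  then show "col_proj U *v (X *v w) = X *v w" and "X *v (col_proj V *v w) = X *v w"
    by (simp_all add: compact_svd_mult[OF assms] col_proj_mult isometry_transpose_mult)
qed

lemma compact_svd_diagonal_mult:
  assumes "is_compact_svd X U S V"
  shows "(S *v z) $ i = S $ i $ i * z $ i"
proof -
  have "(S *v z) $ i = (\<Sum>j\<in>UNIV. if j = i then S $ i $ i * z $ i else 0)"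
    unfolding matrix_vector_mult_def vec_lambda_beta
    using assms by (intro sum.cong) (auto simp: is_compact_svd_def)
  then show ?thesis by simp
qed

text \<open>Links the unordered diagonal of \<open>S\<close> to the ordered SVD. The unit vector
  \<open>w = V *v axis k 1\<close> is a multiple of \<open>(U *v axis k 1) v* X\<close>, hence lies
  in the span of the first \<open>r\<close> right singular vectors, the later singular values being
  \<open>0\<close>. As \<open>norm (X *v w) = S $ k $ k\<close>, the lower Courant-Fischer estimate
  applies.\<close>

lemma singular_value_le_diagonal:
  fixes X :: "real ^ 'n ^ 'm" and U :: "real ^ 'r ^ 'm"
  assumes rank: "rank X = CARD('r)" and X: "is_compact_svd X U S V"
  shows "singular_value X CARD('r) \<le> S $ k $ k"
proof -
  let ?r = "CARD('r)"
  obtain \<sigma> u v where svd: "is_svd X \<sigma> u v" using svd_exists by blast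
  have r: "?r \<in> {1..min_dim X}"
    using rank rank_bound[of X] by (simp add: min_dim_def Suc_leI)
  have U: "transpose U ** U = mat 1" and V: "transpose V ** V = mat 1" and pos: "0 < S $ k $ k"
    using X by (auto simp: is_compact_svd_def)
  have Se: "S *v axis k 1 = S $ k $ k *\<^sub>R axis k 1"
    by (simp add: vec_eq_iff compact_svd_diagonal_mult[OF X] axis_def)
  define w where "w = V *v axis k 1"
  have "norm w = 1" by (simp add: w_def norm_isometry_mult[OF V] norm_axis_1)
  have "X *v w = S $ k $ k *\<^sub>R (U *v axis k 1)"
    by (simp add: compact_svd_mult[OF X] w_def isometry_transpose_mult[OF V] Se
        matrix_vector_mult_scaleR)
  then have Xw: "norm (X *v w) = S $ k $ k"
    using pos by (simp add: norm_isometry_mult[OF U] norm_axis_1)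
  let ?x = "U *v axis k 1"
  have "?x v* X = S $ k $ k *\<^sub>R w"
    by (simp add: compact_svd_mult_left[OF X] w_def isometry_transpose_mult[OF U] Se
        matrix_vector_mult_scaleR)
  then have "w = (1 / S $ k $ k) *\<^sub>R (?x v* X)" using pos by simp
  moreover have "?x v* X \<in> span (v ` {1..?r})"
    unfolding is_svd_mult_left[OF svd]
  proof (rule span_sum)
    fix i assume i: "i \<in> {1..min_dim X}"
    show "(\<sigma> i * (u i \<bullet> ?x)) *\<^sub>R v i \<in> span (v ` {1..?r})"
    proof (cases "i \<le> ?r")
      case True
      then have "v i \<in> v ` {1..?r}" using i by simp
      then show ?thesis by (intro span_scale span_base)
    next
      case False
      then show ?thesis using is_svd_beyond_rank[OF svd i] rank by (simp add: span_zero)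
    qed
  qed
  ultimately have "w \<in> span (v ` {1..?r})" by (metis span_scale)
  from is_svd_norm_ge[OF svd r this] show ?thesis
    by (simp add: Xw \<open>norm w = 1\<close> singular_value_eq[OF svd r])
qed

text \<open>\<open>S\<close> stretches every vector by at least \<open>s\<close>, while
  \<open>U\<close> and \<open>V\<close> preserve norms.\<close>

lemma compact_svd_col_proj_le:
  assumes X: "is_compact_svd X U S V" and s: "0 \<le> s" "\<And>k. s \<le> S $ k $ k"
  shows "s * norm (col_proj U *v y) \<le> norm (y v* X)"
    and "s * norm (x v* V) \<le> norm (X *v x)"
proof -
  have U: "transpose U ** U = mat 1" and V: "transpose V ** V = mat 1"
    using X by (auto simp: is_compact_svd_def)
  have S: "s * norm z \<le> norm (S *v z)" for z
  proof -
    have "norm (s *\<^sub>R z) \<le> norm (S *v z)"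
      using s abs_ge_self order_trans
      by (intro norm_le_componentwise_cart)
        (fastforce simp: compact_svd_diagonal_mult[OF X] abs_mult intro!: mult_right_mono)
    then show ?thesis using s by simp
  qed
  show "s * norm (col_proj U *v y) \<le> norm (y v* X)"
    by (simp add: compact_svd_mult_left[OF X] col_proj_mult norm_isometry_mult[OF U]
        norm_isometry_mult[OF V] S)
  show "s * norm (x v* V) \<le> norm (X *v x)"
    by (simp add: compact_svd_mult[OF X] norm_isometry_mult[OF U] S)
qed

section \<open>From operator to Frobenius bounds; the tangent projection of rank-one
  matrices\<close>

text \<open>The Frobenius norm is at most the sum of the column norms, and each column is the image
  of a unit vector. The crude dimension factor is harmless in a constant depending on
  \<open>X\<close>.\<close>

lemma norm_le_of_operator_bound:
  fixes D :: "real ^ 'n ^ 'm" and c :: real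
  assumes "\<And>w. norm (D *v w) \<le> c * norm w"
  shows "norm D \<le> CARD('n) * c"
proof -
  have "norm D = norm (transpose D)" by (simp add: norm_transpose)
  also have "\<dots> \<le> (\<Sum>j\<in>UNIV. norm (transpose D $ j))"
    unfolding norm_vec_def[of "transpose D"] by (rule L2_set_le_sum) simp
  also have "\<dots> \<le> (\<Sum>j\<in>(UNIV :: 'n set). c)"
  proof (rule sum_mono)
    fix j :: 'n
    have "transpose D $ j = D *v axis j 1"
      by (simp add: matrix_vector_mult_basis column_def transpose_def)
    then show "norm (transpose D $ j) \<le> c"
      using assms[of "axis j 1"] by (simp add: norm_axis_1)
  qed
  finally show ?thesis by simp
qed

lemma tangent_proj_mult:
  "tangent_proj U V Z *v w =
     col_proj U *v (Z *v w) + Z *v (col_proj V *v w) - col_proj U *v (Z *v (col_proj V *v w))"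
  by (simp add: tangent_proj_def matrix_vector_mult_diff_rdistrib matrix_vector_mult_add_rdistrib
      flip: matrix_vector_mul_assoc)

text \<open>Regroups \<open>P Z + Z Q - P Z Q\<close> as \<open>P Z + (1 - P) Z Q\<close>, so that
  each summand has one projected factor, which is small for a discarded term.\<close>

lemma tangent_proj_outer:
  "tangent_proj U V (outer a b) =
     outer (col_proj U *v a) b + outer (a - col_proj U *v a) (col_proj V *v b)"
proof -
  have "b \<bullet> (col_proj V *v w) = (col_proj V *v b) \<bullet> w" for w
    by (metis dot_lmul_matrix mult_col_proj)
  then show ?thesis
    by (simp add: matrix_eq tangent_proj_mult outer_vector_mult matrix_vector_mult_add_rdistrib
        matrix_vector_mult_scaleR scaleR_diff_right)
qed

text \<open>The normal part is a product of two complementary factors; both are of order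
  \<open>norm N\<close> for a kept term.\<close>

lemma outer_minus_tangent_proj:
  "outer a b - tangent_proj U V (outer a b) = outer (a - col_proj U *v a) (b - col_proj V *v b)"
  unfolding tangent_proj_outer by (simp add: vec_eq_iff outer_def algebra_simps)

lemma linear_tangent_proj: "linear (tangent_proj U V)"
  by (rule linearI)
    (simp_all add: matrix_eq tangent_proj_mult matrix_vector_mult_add_rdistrib matrix_vector_right_distrib
      matrix_vector_mult_scaleR scaleR_add_right scaleR_diff_right flip: scaleR_matrix_vector_assoc)

subsection \<open>The two retractions\<close>

text \<open>Stated for every SVD of \<open>X + N\<close>, so the arbitrary choice in
  \<open>truncated_svd\<close> is covered. The factor \<open>min_dim X\<close> counts the rank-one
  terms.\<close>

lemma svd_truncation_minus_tangent_proj: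
  fixes X :: "real ^ 'n ^ 'm" and U :: "real ^ 'r ^ 'm"
  assumes rank: "rank X = CARD('r)" and X: "is_compact_svd X U S V"
    and N: "norm N < singular_value X CARD('r) / 2"
    and svd: "is_svd (X + N) \<sigma> u v"
  shows "norm ((\<Sum>i=1..CARD('r). \<sigma> i *\<^sub>R outer (u i) (v i)) - tangent_proj U V (X + N))
    \<le> min_dim X * (4 / singular_value X CARD('r) * (norm N)\<^sup>2)"
proof -
  let ?r = "CARD('r)" and ?m = "min_dim X"
  define s where "s = singular_value X ?r"
  define T where "T = tangent_proj U V"
  have s: "norm N < s / 2" "0 < s"
    using N norm_ge_zero[of N] unfolding s_def by linarith+
  have diag: "s \<le> S $ k $ k" for k
    unfolding s_def by (rule singular_value_le_diagonal[OF rank X])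
  have U: "transpose U ** U = mat 1" and V: "transpose V ** V = mat 1"
    using X by (auto simp: is_compact_svd_def)
  have r: "?r \<in> {1..?m}"
    using rank rank_bound[of X] by (simp add: min_dim_def Suc_leI)
  have m: "min_dim (X + N) = ?m" by (simp add: min_dim_def)
  obtain \<tau> x y where X_svd: "is_svd X \<tau> x y" using svd_exists by blast
  have unit: "norm (u i) = 1" "norm (v i) = 1" if "i \<in> {1..?m}" for i
    using orthonormal_family_norm is_svd_families[OF svd] that unfolding m by blast+
  have Yv: "X *v v i + N *v v i = \<sigma> i *\<^sub>R u i" and Yu: "u i v* X + u i v* N = \<sigma> i *\<^sub>R v i"
    if "i \<in> {1..?m}" for i
    using is_svd_right_vector[OF svd, of i] is_svd_left_vector[OF svd, of i] that
    by (simp_all add: m matrix_vector_mult_add_rdistrib vector_matrix_mult_add_rdistrib)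
  have nonneg: "0 \<le> \<sigma> i" if "i \<in> {1..?m}" for i
    using is_svd_nonneg[OF svd] that m by simp
  have Nv: "norm (N *v v i) \<le> norm N" "norm (u i v* N) \<le> norm N" if "i \<in> {1..?m}" for i
    using norm_matrix_vector_mult_le[of N "v i"] norm_vector_matrix_mult_le[of "u i" N] unit[OF that]
    by simp_all
  \<comment> \<open>The share of index \<open>i\<close> in the difference: the normal part of a kept
    term, minus the tangent part of a discarded one.\<close>
  define t where "t i = (if i \<le> ?r then \<sigma> i *\<^sub>R (outer (u i) (v i) - T (outer (u i) (v i)))
    else - (\<sigma> i *\<^sub>R T (outer (u i) (v i))))" for i
  have large: "norm (t i) \<le> 4 / s * (norm N)\<^sup>2" if i: "i \<in> {1..?m}" "i \<le> ?r" for i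
  proof -
    let ?a = "u i - col_proj U *v u i" and ?b = "v i - col_proj V *v v i"
    have "\<tau> ?r \<le> \<sigma> ?r + norm N"
      using weyl_singular_values[OF svd X_svd, of ?r] r by (simp add: m)
    moreover have "\<sigma> ?r \<le> \<sigma> i" using is_svd_decreasing[OF svd, of i ?r] i r by (simp add: m)
    ultimately have \<sigma>: "s / 2 \<le> \<sigma> i"
      using s singular_value_eq[OF X_svd r] by (simp add: s_def)
    have "\<sigma> i *\<^sub>R ?a = N *v v i - col_proj U *v (N *v v i)"
      using compact_svd_col_proj(1)[OF X, of "v i"]
      by (simp add: scaleR_diff_right flip: matrix_vector_mult_scaleR Yv[OF i(1)])
        (simp add: matrix_vector_right_distrib)
    then have "norm (\<sigma> i *\<^sub>R ?a) \<le> norm (N *v v i)"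
      using norm_col_proj_le(2)[OF U, of "N *v v i"] by simp
    then have a: "\<sigma> i * norm ?a \<le> norm N" using nonneg[OF i(1)] Nv[OF i(1)] by simp
    have "\<sigma> i *\<^sub>R ?b = u i v* N - col_proj V *v (u i v* N)"
      using compact_svd_col_proj(1)[OF compact_svd_transpose[OF X], of "u i"]
      by (simp add: scaleR_diff_right flip: matrix_vector_mult_scaleR Yu[OF i(1)])
        (simp add: matrix_vector_right_distrib)
    then have "norm (\<sigma> i *\<^sub>R ?b) \<le> norm (u i v* N)"
      using norm_col_proj_le(2)[OF V, of "u i v* N"] by simp
    then have b: "\<sigma> i * norm ?b \<le> norm N" using nonneg[OF i(1)] Nv[OF i(1)] by simp
    have t: "norm (t i) = \<sigma> i * (norm ?a * norm ?b)"
      using i nonneg[OF i(1)] by (simp add: t_def T_def outer_minus_tangent_proj norm_outer)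
    \<comment> \<open>Multiplying by one more \<open>\<sigma> i\<close> gives each of the two
      factors its own \<open>\<sigma> i\<close>; afterwards only one division by
      \<open>s / 2\<close> is needed.\<close>
    have "s / 2 * norm (t i) \<le> \<sigma> i * norm (t i)" using \<sigma> by (intro mult_right_mono) simp_all
    also have "\<dots> = (\<sigma> i * norm ?a) * (\<sigma> i * norm ?b)" by (simp add: t)
    also have "\<dots> \<le> norm N * norm N"
      using a b nonneg[OF i(1)] by (intro mult_mono) simp_all
    finally have "norm (t i) \<le> 2 / s * (norm N)\<^sup>2"
      using s by (simp add: field_simps power2_eq_square)
    \<comment> \<open>Weakened to the constant of the discarded terms, so that one bound serves all
      indices.\<close>
    also have "\<dots> \<le> 4 / s * (norm N)\<^sup>2" using s by (intro mult_right_mono divide_right_mono) simp_all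
    finally show ?thesis .
  qed
  have small: "norm (t i) \<le> 4 / s * (norm N)\<^sup>2" if i: "i \<in> {1..?m}" "\<not> i \<le> ?r" for i
  proof -
    \<comment> \<open>Weyl's inequality against the singular value of \<open>X\<close> at an index
      beyond its rank, which is \<open>0\<close>.\<close>
    have \<sigma>: "\<sigma> i \<le> norm N"
      using weyl_singular_values[OF X_svd svd i(1)] is_svd_beyond_rank[OF X_svd i(1)] i rank by simp
    have "s * norm (col_proj U *v u i) \<le> norm (u i v* X)"
      by (rule compact_svd_col_proj_le(1)[OF X]) (use s diag in auto)
    also have "u i v* X = \<sigma> i *\<^sub>R v i - u i v* N" using Yu[OF i(1)] by (simp add: eq_diff_eq)
    also have "norm \<dots> \<le> norm (\<sigma> i *\<^sub>R v i) + norm (u i v* N)" by (rule norm_triangle_ineq4)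
    also have "\<dots> \<le> 2 * norm N" using \<sigma> nonneg[OF i(1)] Nv[OF i(1)] unit[OF i(1)] by simp
    finally have a: "norm (col_proj U *v u i) \<le> 2 * norm N / s" using s by (simp add: field_simps)
    have "s * norm (col_proj V *v v i) \<le> norm (v i v* transpose X)"
      by (rule compact_svd_col_proj_le(1)[OF compact_svd_transpose[OF X]]) (use s diag in auto)
    also have "v i v* transpose X = \<sigma> i *\<^sub>R u i - N *v v i" using Yv[OF i(1)] by (simp add: eq_diff_eq)
    also have "norm \<dots> \<le> norm (\<sigma> i *\<^sub>R u i) + norm (N *v v i)" by (rule norm_triangle_ineq4)
    also have "\<dots> \<le> 2 * norm N" using \<sigma> nonneg[OF i(1)] Nv[OF i(1)] unit[OF i(1)] by simp
    finally have b: "norm (col_proj V *v v i) \<le> 2 * norm N / s" using s by (simp add: field_simps)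
    have "norm (T (outer (u i) (v i))) \<le> norm (outer (col_proj U *v u i) (v i))
        + norm (outer (u i - col_proj U *v u i) (col_proj V *v v i))"
      unfolding T_def tangent_proj_outer by (rule norm_triangle_ineq)
    \<comment> \<open>Each summand has one projected factor of size at most
      \<open>2 * norm N / s\<close>; the other factor has norm at most \<open>1\<close>.\<close>
    also have "\<dots> \<le> 2 * norm N / s + 1 * (2 * norm N / s)"
      unfolding norm_outer using a b norm_col_proj_le(2)[OF U, of "u i"] unit[OF i(1)]
      by (intro add_mono mult_mono) simp_all
    finally have "norm (T (outer (u i) (v i))) \<le> 4 * norm N / s" by simp
    then have "\<sigma> i * norm (T (outer (u i) (v i))) \<le> norm N * (4 * norm N / s)"
      using \<sigma> by (intro mult_mono) simp_all
    then show ?thesis using i nonneg[OF i(1)] by (simp add: t_def power2_eq_square mult_ac)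
  qed
  have "X + N = (\<Sum>i=1..?m. \<sigma> i *\<^sub>R outer (u i) (v i))" using is_svd_sum[OF svd] by (simp add: m)
  then have TY: "T (X + N) = (\<Sum>i=1..?m. \<sigma> i *\<^sub>R T (outer (u i) (v i)))"
    by (simp add: T_def linear_sum[OF linear_tangent_proj] linear_cmul[OF linear_tangent_proj])
  \<comment> \<open>Padding the truncated sum with zeros permits termwise subtraction.\<close>
  have "(\<Sum>i=1..?r. \<sigma> i *\<^sub>R outer (u i) (v i))
      = (\<Sum>i=1..?m. if i \<le> ?r then \<sigma> i *\<^sub>R outer (u i) (v i) else 0)"
    using r by (intro sum.mono_neutral_cong_left) auto
  then have "(\<Sum>i=1..?r. \<sigma> i *\<^sub>R outer (u i) (v i)) - T (X + N) = (\<Sum>i=1..?m. t i)"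
    by (simp only: TY flip: sum_subtractf)
      (rule sum.cong, simp_all add: t_def scaleR_diff_right)
  also have "norm \<dots> \<le> (\<Sum>i=1..?m. 4 / s * (norm N)\<^sup>2)"
    by (rule sum_norm_le) (use large small in blast)
  finally show ?thesis by (simp add: s_def T_def)
qed

text \<open>Existence of an SVD makes the chosen truncation a genuine one, and the rank bound
  reduces its number of terms to \<open>r\<close>.\<close>

lemma retr_proj_minus_tangent_proj:
  fixes X :: "real ^ 'n ^ 'm" and U :: "real ^ 'r ^ 'm"
  assumes rank: "rank X = CARD('r)" and X: "is_compact_svd X U S V"
    and N: "norm N < singular_value X CARD('r) / 2"
  shows "norm (retr_proj CARD('r) X N - tangent_proj U V (X + N))
    \<le> min_dim X * (4 / singular_value X CARD('r) * (norm N)\<^sup>2)"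
proof -
  have "min CARD('r) (min_dim (X + N)) = CARD('r)"
    using rank rank_bound[of X] by (simp add: min_dim_def)
  moreover have "\<exists>Z \<sigma> u v. is_svd (X + N) \<sigma> u v \<and>
      Z = (\<Sum>i=1..min CARD('r) (min_dim (X + N)). \<sigma> i *\<^sub>R outer (u i) (v i))"
    using svd_exists[of "X + N"] by blast
  note someI_ex[OF this]
  ultimately obtain \<sigma> u v where "is_svd (X + N) \<sigma> u v"
    and "retr_proj CARD('r) X N = (\<Sum>i=1..CARD('r). \<sigma> i *\<^sub>R outer (u i) (v i))"
    unfolding retr_proj_def truncated_svd_def by auto
  then show ?thesis using svd_truncation_minus_tangent_proj[OF rank X N] by simp
qed

section \<open>The orthographic retraction\<close>

lemma retr_orth_minus_tangent_proj:
  fixes X :: "real ^ 'n ^ 'm" and U :: "real ^ 'r ^ 'm"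
  assumes rank: "rank X = CARD('r)" and X: "is_compact_svd X U S V"
    and N: "norm N < singular_value X CARD('r) / 2"
  shows "norm (retr_orth U V X N - tangent_proj U V (X + N))
    \<le> CARD('n) * (2 / singular_value X CARD('r) * (norm N)\<^sup>2)"
proof (rule norm_le_of_operator_bound)
  define s where "s = singular_value X CARD('r)"
  define Y where "Y = X + N"
  have s: "norm N < s / 2" "0 < s"
    using N norm_ge_zero[of N] unfolding s_def by linarith+
  have diag: "s \<le> S $ k $ k" for k
    unfolding s_def by (rule singular_value_le_diagonal[OF rank X])
  have U: "transpose U ** U = mat 1" and V: "transpose V ** V = mat 1"
    using X by (auto simp: is_compact_svd_def)
  define M where "M = transpose U ** Y ** V"
  have M: "M *v z = (Y *v (V *v z)) v* U" for z
    by (simp add: M_def flip: matrix_vector_mul_assoc)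
  \<comment> \<open>The part of \<open>M\<close> from \<open>X\<close> stretches by at least
    \<open>s\<close>, since \<open>transpose U\<close> preserves norms on the range of
    \<open>X\<close>; the part from \<open>N\<close> removes at most \<open>s / 2\<close>.\<close>
  have M_ge: "s / 2 * norm z \<le> norm (M *v z)" for z
  proof -
    have "M *v z = (X *v (V *v z)) v* U + (N *v (V *v z)) v* U"
      by (simp add: M Y_def matrix_vector_mult_add_rdistrib vector_matrix_left_distrib)
    moreover have "s * norm z \<le> norm ((X *v (V *v z)) v* U)"
    proof -
      have "s * norm z = s * norm ((V *v z) v* V)" by (simp add: isometry_transpose_mult[OF V])
      also have "\<dots> \<le> norm (X *v (V *v z))"
        by (rule compact_svd_col_proj_le(2)[OF X]) (use s diag in auto)
      also have "\<dots> = norm ((X *v (V *v z)) v* U)"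
        using compact_svd_col_proj(1)[OF X, of "V *v z"]
        by (metis col_proj_mult norm_isometry_mult[OF U])
      finally show ?thesis .
    qed
    moreover have "norm ((N *v (V *v z)) v* U) \<le> s / 2 * norm z"
    proof -
      have "norm ((N *v (V *v z)) v* U) \<le> norm N * norm z"
        using norm_isometry_transpose_le[OF U, of "N *v (V *v z)"]
          norm_matrix_vector_mult_le[of N "V *v z"] norm_isometry_mult[OF V, of z] by simp
      also have "\<dots> \<le> s / 2 * norm z" using s by (intro mult_right_mono) simp_all
      finally show ?thesis .
    qed
    ultimately show ?thesis
      using norm_diff_ineq[of "(X *v (V *v z)) v* U" "(N *v (V *v z)) v* U"] by simp
  qed
  \<comment> \<open>The lower bound makes the square matrix \<open>M\<close> injective, so
    \<open>matrix_inv M\<close> is a true two-sided inverse.\<close>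
  have "inj ((*v) M)"
  proof (rule injI)
    fix a b assume "M *v a = M *v b"
    then have "s / 2 * norm (a - b) \<le> 0"
      using M_ge[of "a - b"] by (simp add: matrix_vector_mult_diff_distrib)
    then show "a = b" using s by (simp add: mult_le_0_iff)
  qed
  then have "invertible M"
    by (simp add: invertible_left_inverse matrix_left_invertible_injective)
  then have inv: "M ** matrix_inv M = mat 1 \<and> matrix_inv M ** M = mat 1"
    unfolding invertible_def matrix_inv_def by (rule someI_ex)
  have inv1: "matrix_inv M *v (M *v z) = z" and inv2: "M *v (matrix_inv M *v z) = z" for z
    by (simp_all add: inv matrix_vector_mul_assoc)
  fix w
  \<comment> \<open>\<open>q\<close> is the component of \<open>w\<close> killed by
    \<open>X\<close>, and \<open>b\<close> is the correction it causes after inverting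
    \<open>M\<close>. Both \<open>Y *v q\<close> and \<open>b\<close> thus carry a factor
    \<open>N\<close>.\<close>
  define q where "q = w - col_proj V *v w"
  define b where "b = matrix_inv M *v ((N *v q) v* U)"
  have Yq: "Y *v q = N *v q"
    using compact_svd_col_proj(2)[OF X, of w]
    by (simp add: Y_def q_def matrix_vector_mult_add_rdistrib matrix_vector_mult_diff_distrib)
  have w: "w = V *v (w v* V) + q" by (simp add: q_def col_proj_mult)
  \<comment> \<open>On the component \<open>V *v (w v* V)\<close> the compressed action is that of
    \<open>M\<close> itself, so the inverse returns \<open>w v* V\<close> exactly.\<close>
  have "(Y *v w) v* U = (Y *v (V *v (w v* V))) v* U + (Y *v q) v* U"
    by (subst w) (simp only: matrix_vector_right_distrib vector_matrix_left_distrib)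
  then have "matrix_inv M *v ((Y *v w) v* U) = w v* V + b"
    by (simp add: Yq b_def matrix_vector_right_distrib inv1 flip: M)
  moreover have "retr_orth U V X N *v w = Y *v (V *v (matrix_inv M *v ((Y *v w) v* U)))"
    by (simp add: retr_orth_def flip: M_def Y_def matrix_vector_mul_assoc)
  ultimately have R: "retr_orth U V X N *v w = Y *v (col_proj V *v w) + Y *v (V *v b)"
    by (simp add: matrix_vector_right_distrib col_proj_mult)
  \<comment> \<open>By the choice of \<open>b\<close>, the tangential part of the correction equals
    the term \<open>col_proj U *v (Y *v q)\<close> of the tangent projection. Only its normal part
    survives, and there \<open>X\<close> drops out.\<close>
  have "col_proj U *v (Y *v (V *v b)) = U *v (M *v b)" by (simp add: col_proj_mult M)
  also have "\<dots> = col_proj U *v (Y *v q)" by (simp add: b_def inv2 Yq col_proj_mult)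
  finally have PYVb: "col_proj U *v (Y *v (V *v b)) = col_proj U *v (Y *v q)" .
  have "(retr_orth U V X N - tangent_proj U V Y) *v w = Y *v (V *v b) - col_proj U *v (Y *v q)"
    by (simp add: matrix_vector_mult_diff_rdistrib R tangent_proj_mult q_def
        matrix_vector_mult_diff_distrib)
  also have "\<dots> = Y *v (V *v b) - col_proj U *v (Y *v (V *v b))" by (simp add: PYVb)
  also have "\<dots> = N *v (V *v b) - col_proj U *v (N *v (V *v b))"
    using compact_svd_col_proj(1)[OF X, of "V *v b"]
    by (simp add: Y_def matrix_vector_mult_add_rdistrib matrix_vector_right_distrib)
  finally have "norm ((retr_orth U V X N - tangent_proj U V Y) *v w) \<le> norm (N *v (V *v b))"
    using norm_col_proj_le(2)[OF U, of "N *v (V *v b)"] by simp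
  also have "\<dots> \<le> norm N * norm b"
    using norm_matrix_vector_mult_le[of N "V *v b"] by (simp add: norm_isometry_mult[OF V])
  \<comment> \<open>The second factor \<open>norm N\<close> comes from \<open>b\<close>, and
    \<open>2 / s\<close> from the lower bound on \<open>M\<close>.\<close>
  also have "\<dots> \<le> norm N * (2 / s * (norm N * norm w))"
  proof (rule mult_left_mono)
    have "s / 2 * norm b \<le> norm ((N *v q) v* U)" using M_ge[of b] by (simp add: b_def inv2)
    also have "\<dots> \<le> norm N * norm q"
      using norm_isometry_transpose_le[OF U, of "N *v q"] norm_matrix_vector_mult_le[of N q] by simp
    also have "\<dots> \<le> norm N * norm w"
      unfolding q_def by (intro mult_left_mono norm_col_proj_le(2)[OF V]) simp
    finally show "norm b \<le> 2 / s * (norm N * norm w)" using s by (simp add: field_simps)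
  qed simp
  finally show "norm ((retr_orth U V X N - tangent_proj U V (X + N)) *v w)
      \<le> 2 / singular_value X CARD('r) * (norm N)\<^sup>2 * norm w"
    by (simp add: Y_def s_def power2_eq_square mult_ac)
qed

theorem lemma3:
  fixes X :: "real ^ 'n2 ^ 'n1"
  assumes "rank X = CARD('r::finite)"
  shows "\<exists>C. \<forall>(U :: real ^ 'r ^ 'n1) (S :: real ^ 'r ^ 'r) (V :: real ^ 'r ^ 'n2) (N :: real ^ 'n2 ^ 'n1).
           is_compact_svd X U S V \<longrightarrow>
           norm N < singular_value X CARD('r) / 2 \<longrightarrow>
             norm (retr_proj CARD('r) X N - tangent_proj U V (X + N)) \<le> C * (norm N)\<^sup>2 \<and>
             norm (retr_orth U V X N - tangent_proj U V (X + N)) \<le> C * (norm N)\<^sup>2"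
proof -
  let ?s = "singular_value X CARD('r)"
  \<comment> \<open>The larger of the two constants. It is fixed before \<open>U\<close>,
    \<open>S\<close>, \<open>V\<close> and \<open>N\<close>, so it is also uniform over all compact
    decompositions of \<open>X\<close>.\<close>
  let ?C = "max (min_dim X * (4 / ?s)) (CARD('n2) * (2 / ?s))"
  show ?thesis
  proof (intro exI[of _ ?C] allI impI)
    fix U :: "real ^ 'r ^ 'n1" and S :: "real ^ 'r ^ 'r" and V :: "real ^ 'r ^ 'n2"
      and N :: "real ^ 'n2 ^ 'n1"
    assume X: "is_compact_svd X U S V" and N: "norm N < ?s / 2"
    have "min_dim X * (4 / ?s) * (norm N)\<^sup>2 \<le> ?C * (norm N)\<^sup>2"
      and "CARD('n2) * (2 / ?s) * (norm N)\<^sup>2 \<le> ?C * (norm N)\<^sup>2"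
      by (intro mult_right_mono; simp)+
    then show "norm (retr_proj CARD('r) X N - tangent_proj U V (X + N)) \<le> ?C * (norm N)\<^sup>2 \<and>
        norm (retr_orth U V X N - tangent_proj U V (X + N)) \<le> ?C * (norm N)\<^sup>2"
      using retr_proj_minus_tangent_proj[OF assms X N] retr_orth_minus_tangent_proj[OF assms X N]
      by (simp only: mult.assoc) linarith
  qed
qed

end
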